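(* Let $\delta$ be a positive integer and let $\beta,\nu$ be real numbers with $\nu>0$. Let $(T_n(x))_{n\ge\delta-1}$ be polynomials with $T_{\delta-1}(x)=1$, $\deg(T_n(x))=n-\delta+1$, and, for $n\ge\delta-1$, $$T_{n+1}(x)=\bigl((n-\delta+1)\nu x^2+\beta x+\beta+(n-\delta+1)\nu\bigr)T_n(x)+\nu\bigl(-x^3+x^2-x+1\bigr)\frac{d}{dx}T_n(x).$$ Then: (i) the exponential generating function is $$\sum_{n\ge0}T_{n+\delta-1}(x)\frac{t^n}{n!}=\frac{(1-x)^{\beta/\nu}}{\bigl[(1-x)\cos(\nu(1-x)t)-(1+x)\sin(\nu(1-x)t)\bigr]^{\beta/\nu}};$$ (ii) the ordinary generating function has the Jacobi continued fraction expansion $$\sum_{n=0}^{\infty}T_{n+\delta-1}(x)t^n=\cfrac{1}{1-r_0t-\cfrac{s_1t^2}{1-r_1t-\cfrac{s_2t^2}{1-r_2t-\cdots}}},$$ where $r_i=(2\nu i+\beta)(1+x)$ for $i\ge0$ and $s_i=2\nu i[\beta+\nu(i-1)](1+x^2)$ for $i\ge 1$; (iii) the polynomial sequence $(T_n(q))_{n\ge\delta-1}$ is strongly $q$-log-convex for $\beta\ge0$; (iv) the polynomial $T_n(x)$ is not $\gamma$-positive for $n\ge\delta+2$ and $\beta\ge0$.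
   Context: The right-hand side of (i) is understood as a formal power series in $t$ (for $x\ne1$), namely $\bigl[\cos(\nu(1-x)t)-\frac{1+x}{1-x}\sin(\nu(1-x)t)\bigr]^{-\beta/\nu}$. A polynomial sequence $(f_n(q))_{n\ge0}$ is strongly $q$-log-convex if $f_{n+1}(q)f_{m-1}(q)-f_n(q)f_m(q)$ has only nonnegative coefficients for all $n\ge m\ge1$ (here applied to $f_n=T_{n+\delta-1}$). A symmetric polynomial $f$ of degree $d$ (that is, $f(x)=x^df(1/x)$) is $\gamma$-positive if in the expansion $f(x)=\sum_{k=0}^{\lfloor d/2\rfloor}g_kx^k(1+x)^{d-2k}$ all $g_k\ge0$. Note that the degree hypothesis forces $\beta\neq 0$. *)

theory Defs
  imports "HOL-Computational_Algebra.Computational_Algebra"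
begin

(* f^a for a series f with constant coefficient 1 (the only case with a meaning),
   as the substitution of f - 1 into the binomial series (1 + X)^a. *)
definition fps_rpow :: "real fps \<Rightarrow> real \<Rightarrow> real fps" where
  "fps_rpow f a = fps_compose (fps_binomial a) (f - 1)"

(* jfrac_convergent r s k i is the tail starting at level i of the Jacobi continued fraction,
     1 / (1 - r i * t - s (i+1) * t^2 / (1 - r (i+1) * t - ...)),
   truncated to k levels.  The denominators have constant coefficient 1, so they are
   invertible over any commutative ring; fps_right_inverse _ 1 is that inverse
   ("inverse" is unavailable when the coefficients are polynomials). *)
primrec jfrac_convergent ::
  "(nat \<Rightarrow> 'a::comm_ring_1) \<Rightarrow> (nat \<Rightarrow> 'a) \<Rightarrow> nat \<Rightarrow> nat \<Rightarrow> 'a fps" where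
  "jfrac_convergent r s 0 i = 0"
| "jfrac_convergent r s (Suc k) i =
     fps_right_inverse
       (1 - fps_const (r i) * fps_X
          - fps_const (s (Suc i)) * fps_X ^ 2 * jfrac_convergent r s k (Suc i)) 1"

(* Convergence is in the X-adic topology on formal power series. *)
definition has_jfrac_expansion ::
  "'a::comm_ring_1 fps \<Rightarrow> (nat \<Rightarrow> 'a) \<Rightarrow> (nat \<Rightarrow> 'a) \<Rightarrow> bool" where
  "has_jfrac_expansion F r s \<longleftrightarrow> (\<lambda>k. jfrac_convergent r s k 0) \<longlonglongrightarrow> F"

definition strongly_q_log_convex :: "(nat \<Rightarrow> real poly) \<Rightarrow> bool" where
  "strongly_q_log_convex f \<longleftrightarrow>
     (\<forall>m n. 1 \<le> m \<and> m \<le> n \<longrightarrow>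
        (\<forall>i. coeff (f (n + 1) * f (m - 1) - f n * f m) i \<ge> 0))"

(* reflect_poly f is x^d f(1/x) with d = degree f. *)
definition gamma_positive :: "real poly \<Rightarrow> bool" where
  "gamma_positive f \<longleftrightarrow>
     reflect_poly f = f \<and>
     (\<exists>g :: nat \<Rightarrow> real. (\<forall>k \<le> degree f div 2. g k \<ge> 0) \<and>
        f = (\<Sum>k \<le> degree f div 2.
               smult (g k) ([:0, 1:] ^ k * [:1, 1:] ^ (degree f - 2 * k))))"

end

(* Put y = 1 + x, z = 1 + x^2 and f = cos (nu (1-x) t) - (1+x)/(1-x) sin (nu (1-x) t), and let
   G = f^(-beta/nu), h = -f'/(nu f), e = (h^2 + (1-x)^2)/2.  Then
     G' = beta h G,   h' = 2 nu e,   e' = 2 nu h e,   with G, h, e = 1, y, z at t = 0.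
   Differentiating G h^a e^b in t gives the same combination of such terms as applying the
   recurrence operator of index a + 2b to y^a z^b, so T_n is the n-th Taylor derivative of G.

   Writing h = y + 2 nu z phi, the series G phi^k / k! are the exponential generating functions of
   the columns of the array with production matrix (1, r_k, s_k); its column 0 has the stated
   Jacobi fraction.  Since r_k r_(k+1) - s_(k+1) has nonnegative coefficients, the production
   matrix is coefficientwise totally positive of order 2, hence so is the array, which gives the
   log-convexity.

   Finally T_n is congruent to beta^n (1+x)^n modulo 1 + x^2, and x^k (1+x)^(n-2k) to
   2^(-k) (1+x)^n.  Gamma-positivity would thus give T_n(0) = g_0 <= sum g_k / 2^k = beta^n,
   but T_n(0) > beta^n for n >= 2. *)
theory Submission
  imports Defs
begin

section \<open>Jacobi arrays and their continued fractions\<close>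

text \<open>Entry (n, k) is the total weight of the Motzkin paths of length n from height 0 to
  height k, where a rise weighs 1, a level step at height i weighs \<open>r i\<close> and a fall
  from height i weighs \<open>s i\<close>.\<close>

primrec jacobi_array :: "(nat \<Rightarrow> 'a::comm_ring_1) \<Rightarrow> (nat \<Rightarrow> 'a) \<Rightarrow> nat \<Rightarrow> nat \<Rightarrow> 'a" where
  "jacobi_array r s 0 = (\<lambda>k. if k = 0 then 1 else 0)"
| "jacobi_array r s (Suc n) = (\<lambda>k.
     (case k of 0 \<Rightarrow> 0 | Suc j \<Rightarrow> jacobi_array r s n j)
     + r k * jacobi_array r s n k + s (Suc k) * jacobi_array r s n (Suc k))"

declare jacobi_array.simps(2) [simp del]

lemma jacobi_array_Suc_0:
  "jacobi_array r s (Suc n) 0 = r 0 * jacobi_array r s n 0 + s 1 * jacobi_array r s n 1"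
  by (simp add: jacobi_array.simps(2))

lemma jacobi_array_Suc_Suc:
  "jacobi_array r s (Suc n) (Suc k) = jacobi_array r s n k
     + r (Suc k) * jacobi_array r s n (Suc k) + s (Suc (Suc k)) * jacobi_array r s n (Suc (Suc k))"
  by (simp add: jacobi_array.simps(2))

definition jacobi_column :: "(nat \<Rightarrow> 'a::comm_ring_1) \<Rightarrow> (nat \<Rightarrow> 'a) \<Rightarrow> nat \<Rightarrow> 'a fps" where
  "jacobi_column r s k = Abs_fps (\<lambda>n. jacobi_array r s n k)"

text \<open>The value 1 at 0 makes the column recurrence uniform; column 0 divided by
  \<^term>\<open>pred_column r s 0\<close> is the whole fraction, and in general column \<open>i\<close> divided by
  \<^term>\<open>pred_column r s i\<close> is its tail from level \<open>i\<close>.\<close>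

definition pred_column :: "(nat \<Rightarrow> 'a::comm_ring_1) \<Rightarrow> (nat \<Rightarrow> 'a) \<Rightarrow> nat \<Rightarrow> 'a fps" where
  "pred_column r s k = (case k of 0 \<Rightarrow> 1 | Suc j \<Rightarrow> fps_X * jacobi_column r s j)"

lemma jacobi_column_rec:
  "jacobi_column r s k = pred_column r s k + fps_const (r k) * fps_X * jacobi_column r s k
     + fps_const (s (Suc k)) * fps_X * jacobi_column r s (Suc k)"
proof (rule fps_ext)
  fix n
  show "jacobi_column r s k $ n = (pred_column r s k
     + fps_const (r k) * fps_X * jacobi_column r s k
     + fps_const (s (Suc k)) * fps_X * jacobi_column r s (Suc k)) $ n"
    by (cases n; cases k)
       (simp_all add: jacobi_column_def pred_column_def jacobi_array_Suc_0 jacobi_array_Suc_Suc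
          mult.assoc)
qed

text \<open>The error is stated with the denominator cleared, since \<open>pred_column r s i\<close>
  is not invertible for i > 0. Unfolding one level of the fraction turns the error at level i into a
  multiple of X times the error at level i + 1.\<close>

lemma jfrac_convergent_error:
  "fps_X ^ k dvd pred_column r s i * jfrac_convergent r s k i - jacobi_column r s i"
proof (induction k arbitrary: i)
  case (Suc k)
  let ?B = "jacobi_column r s" and ?P = "pred_column r s"
  define C where "C = jfrac_convergent r s k (Suc i)"
  define C' where "C' = jfrac_convergent r s (Suc k) i"
  define a where "a = fps_const (r i) * fps_X"
  define b where "b = fps_const (s (Suc i))"
  have inv: "(1 - a - b * fps_X ^ 2 * C) * C' = 1"
    unfolding C'_def C_def a_def b_def jfrac_convergent.simps
    by (rule fps_right_inverse) simp
  have B: "?B i = ?P i + a * ?B i + b * fps_X * ?B (Suc i)"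
    unfolding a_def b_def by (rule jacobi_column_rec)
  \<comment> \<open>The denominator times \<open>C'\<close> is 1, so \<open>?B i\<close> may be
    multiplied by that product and \<open>C'\<close> factored out. The column recurrence and
    \<open>?P (Suc i) = fps_X * ?B i\<close> then expose the error of the next level.\<close>
  have "?P i * C' - ?B i = C' * (?P i - ?B i * (1 - a - b * fps_X ^ 2 * C))"
  proof -
    have "?B i = ?B i * ((1 - a - b * fps_X ^ 2 * C) * C')"
      by (simp add: inv)
    then show ?thesis by (simp add: algebra_simps)
  qed
  also have "?P i - ?B i * (1 - a - b * fps_X ^ 2 * C) = b * (fps_X * (?P (Suc i) * C - ?B (Suc i)))"
    using B by (simp add: pred_column_def algebra_simps power2_eq_square)
  also have "fps_X ^ Suc k dvd C' * (b * (fps_X * (?P (Suc i) * C - ?B (Suc i))))"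
    using Suc.IH[of "Suc i"] unfolding C_def power_Suc by (intro dvd_mult mult_dvd_mono dvd_refl)
  finally show ?case unfolding C'_def .
qed simp

text \<open>Column 0 has predecessor 1, so by the error bound the k-th convergent agrees with it in
  all degrees below k.\<close>

lemma has_jfrac_expansion_jacobi_column: "has_jfrac_expansion (jacobi_column r s 0) r s"
  unfolding has_jfrac_expansion_def
proof (rule tendsto_fpsI)
  fix n
  show "\<forall>\<^sub>F k in sequentially. jfrac_convergent r s k 0 $ n = jacobi_column r s 0 $ n"
  proof (rule eventually_sequentiallyI[of "Suc n"])
    fix k assume k: "Suc n \<le> k"
    obtain c where "jfrac_convergent r s k 0 - jacobi_column r s 0 = fps_X ^ k * c"
      using jfrac_convergent_error[of k r s 0] by (auto simp: pred_column_def)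
    then have "(jfrac_convergent r s k 0 - jacobi_column r s 0) $ n = (fps_X ^ k * c) $ n"
      by simp
    also have "\<dots> = 0" using k by (simp add: fps_X_power_mult_nth)
    finally show "jfrac_convergent r s k 0 $ n = jacobi_column r s 0 $ n" by simp
  qed
qed

section \<open>Coefficientwise total positivity of order 2\<close>

definition nonneg_coeffs :: "'a::linordered_idom poly \<Rightarrow> bool" where
  "nonneg_coeffs p \<longleftrightarrow> (\<forall>i. coeff p i \<ge> 0)"

lemma nonneg_coeffs_0 [simp]: "nonneg_coeffs 0"
  by (simp add: nonneg_coeffs_def)

lemma nonneg_coeffs_1 [simp]: "nonneg_coeffs 1"
  by (simp add: nonneg_coeffs_def)

lemma nonneg_coeffs_pCons [simp]: "nonneg_coeffs (pCons a p) \<longleftrightarrow> a \<ge> 0 \<and> nonneg_coeffs p"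
  unfolding nonneg_coeffs_def by (metis coeff_pCons_0 coeff_pCons_Suc not0_implies_Suc)

lemma nonneg_coeffs_add: "nonneg_coeffs p \<Longrightarrow> nonneg_coeffs q \<Longrightarrow> nonneg_coeffs (p + q)"
  by (simp add: nonneg_coeffs_def)

lemma nonneg_coeffs_mult: "nonneg_coeffs p \<Longrightarrow> nonneg_coeffs q \<Longrightarrow> nonneg_coeffs (p * q)"
  by (simp add: nonneg_coeffs_def coeff_mult sum_nonneg)

context
  fixes r s :: "nat \<Rightarrow> real poly"
  assumes r: "\<And>k. nonneg_coeffs (r k)"
    and s: "\<And>k. nonneg_coeffs (s (Suc k))"
begin

lemma nonneg_coeffs_jacobi_array: "nonneg_coeffs (jacobi_array r s n k)"
  by (induction n arbitrary: k)
     (auto simp: jacobi_array.simps(2) intro!: nonneg_coeffs_add nonneg_coeffs_mult r s split: nat.split)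

context
  assumes rs: "\<And>k. nonneg_coeffs (r k * r (Suc k) - s (Suc k))"
begin

text \<open>Induction on the upper row with the row distance d fixed: expanding both rows by the
  recurrence writes the minor as a combination of minors of the previous two rows, as in
  Cauchy-Binet.\<close>

lemma nonneg_coeffs_jacobi_minor:
  assumes "k < l"
  shows "nonneg_coeffs (jacobi_array r s m k * jacobi_array r s (m + d) l
           - jacobi_array r s m l * jacobi_array r s (m + d) k)"
  using assms
proof (induction m arbitrary: k l)
  case 0
  then show ?case by (simp add: nonneg_coeffs_jacobi_array)
next
  case (Suc m)
  define a where "a = jacobi_array r s m"
  define b where "b = jacobi_array r s (m + d)"
  \<comment> \<open>These are the rows shifted by a rise; the value 0 at k = 0 lets column 0 follow
    the general formula.\<close>
  define a' where "a' k = (case k of 0 \<Rightarrow> 0 | Suc j \<Rightarrow> a j)" for k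
  define b' where "b' k = (case k of 0 \<Rightarrow> 0 | Suc j \<Rightarrow> b j)" for k
  have IH: "nonneg_coeffs (a i * b j - a j * b i)" if "i \<le> j" for i j
    using Suc.IH[of i j] that unfolding a_def b_def by (cases "i = j") simp_all
  have IH': "nonneg_coeffs (a' i * b j - a j * b' i)" if "i \<le> Suc j" for i j
    using IH that by (auto simp: a'_def b'_def split: nat.split)
  have IH'': "nonneg_coeffs (a' k * b' l - a' l * b' k)"
    using IH Suc.prems by (auto simp: a'_def b'_def split: nat.split)
  obtain j where l: "l = Suc j" using Suc.prems by (cases l) auto
  have kj: "k \<le> j" using Suc.prems l by simp
  \<comment> \<open>The only minor that can have its columns in the wrong order is (k + 1, j),
    namely when l = k + 1. It is then the negative of the minor (k, l), and the two terms merge with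
    the factor \<open>r k * r (Suc k) - s (Suc k)\<close>.\<close>
  have mid: "nonneg_coeffs (r k * r l * (a k * b l - a l * b k)
      + s (Suc k) * (a (Suc k) * b j - a j * b (Suc k)))"
  proof (cases "j = k")
    case True
    have "r k * r l * (a k * b l - a l * b k) + s (Suc k) * (a (Suc k) * b j - a j * b (Suc k))
        = (r k * r (Suc k) - s (Suc k)) * (a k * b (Suc k) - a (Suc k) * b k)"
      by (simp add: True l algebra_simps)
    then show ?thesis using IH[of k "Suc k"] rs[of k] by (simp add: nonneg_coeffs_mult)
  next
    case False
    then show ?thesis using kj l
      by (intro nonneg_coeffs_add nonneg_coeffs_mult r s IH) auto
  qed
  \<comment> \<open>The nine products from the three terms of each recurrence; the last two are
    those of \<open>mid\<close>.\<close>
  have eq: "jacobi_array r s (Suc m) k * jacobi_array r s (Suc m + d) l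
           - jacobi_array r s (Suc m) l * jacobi_array r s (Suc m + d) k
      = (a' k * b' l - a' l * b' k)
        + r l * (a' k * b l - a l * b' k)
        + s (Suc l) * (a' k * b (Suc l) - a (Suc l) * b' k)
        + r k * (a k * b j - a j * b k)
        + r k * s (Suc l) * (a k * b (Suc l) - a (Suc l) * b k)
        + s (Suc k) * r l * (a (Suc k) * b l - a l * b (Suc k))
        + s (Suc k) * s (Suc l) * (a (Suc k) * b (Suc l) - a (Suc l) * b (Suc k))
        + (r k * r l * (a k * b l - a l * b k)
           + s (Suc k) * (a (Suc k) * b j - a j * b (Suc k)))"
  proof -
    have "jacobi_array r s (Suc m) k = a' k + r k * a k + s (Suc k) * a (Suc k)"
         "jacobi_array r s (Suc m + d) k = b' k + r k * b k + s (Suc k) * b (Suc k)" for k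
      by (simp_all add: jacobi_array.simps(2) a_def b_def a'_def b'_def split: nat.split)
    moreover have "a' l = a j" "b' l = b j" by (simp_all add: a'_def b'_def l)
    ultimately show ?thesis by (simp add: algebra_simps)
  qed
  show ?case unfolding eq using kj l
    by (intro nonneg_coeffs_add nonneg_coeffs_mult mid IH IH' IH'' r s) auto
qed

text \<open>Expanding rows n + 1 and m, the \<open>r 0\<close> terms cancel, and what remains is
  \<open>s 1\<close> times the minor of rows m - 1 and n in columns 0 and 1.\<close>

lemma strongly_q_log_convex_jacobi_array: "strongly_q_log_convex (\<lambda>n. jacobi_array r s n 0)"
  unfolding strongly_q_log_convex_def
proof (intro allI impI)
  fix m n i :: nat assume "1 \<le> m \<and> m \<le> n"
  then obtain j d where m: "m = Suc j" and n: "n = j + d"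
    by (metis Suc_le_D le_add_diff_inverse One_nat_def Suc_leD)
  have "jacobi_array r s (n + 1) 0 * jacobi_array r s (m - 1) 0 - jacobi_array r s n 0 * jacobi_array r s m 0
      = s 1 * (jacobi_array r s j 0 * jacobi_array r s (j + d) 1 - jacobi_array r s j 1 * jacobi_array r s (j + d) 0)"
    by (simp add: m n jacobi_array_Suc_0 algebra_simps)
  moreover have "nonneg_coeffs \<dots>"
    using s[of 0] by (intro nonneg_coeffs_mult nonneg_coeffs_jacobi_minor) auto
  ultimately show "coeff (jacobi_array r s (n + 1) 0 * jacobi_array r s (m - 1) 0
      - jacobi_array r s n 0 * jacobi_array r s m 0) i \<ge> 0"
    by (simp add: nonneg_coeffs_def)
qed

end

end

section \<open>The recurrence operator and its lift to power series\<close>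

text \<open>The given sequence read from index \<delta> - 1 on.\<close>

primrec T_poly :: "real \<Rightarrow> real \<Rightarrow> nat \<Rightarrow> real poly" where
  "T_poly \<beta> \<nu> 0 = 1"
| "T_poly \<beta> \<nu> (Suc n) = [:\<beta> + real n * \<nu>, \<beta>, real n * \<nu>:] * T_poly \<beta> \<nu> n
     + smult \<nu> [:1, -1, 1, -1:] * pderiv (T_poly \<beta> \<nu> n)"

definition T_diag :: "real \<Rightarrow> real \<Rightarrow> nat \<Rightarrow> real poly" where
  "T_diag \<beta> \<nu> i = smult (2 * \<nu> * real i + \<beta>) [:1, 1:]"

definition T_offdiag :: "real \<Rightarrow> real \<Rightarrow> nat \<Rightarrow> real poly" where
  "T_offdiag \<beta> \<nu> i = smult (2 * \<nu> * real i * (\<beta> + \<nu> * (real i - 1))) [:1, 0, 1:]"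

text \<open>The second series arises from the polynomial of degree at most \<open>n\<close> by substituting
  \<open>h\<close> for \<open>1 + x\<close> and \<open>e\<close> for \<open>1 + x\<^sup>2\<close> in a homogeneous representation of weight \<open>n\<close>,
  and multiplying by \<open>G\<close>.\<close>

inductive lifted :: "real fps \<Rightarrow> real fps \<Rightarrow> real fps \<Rightarrow> nat \<Rightarrow> real poly \<Rightarrow> real fps \<Rightarrow> bool"
  for G h e where
  monomial: "lifted G h e (a + 2 * b) ([:1, 1:] ^ a * [:1, 0, 1:] ^ b) (G * h ^ a * e ^ b)"
| add: "lifted G h e n p F \<Longrightarrow> lifted G h e n q H \<Longrightarrow> lifted G h e n (p + q) (F + H)"
| smult: "lifted G h e n p F \<Longrightarrow> lifted G h e n (smult c p) (fps_const c * F)"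

text \<open>At t = 0 the substitution is undone, as h and e start with 1 + x and 1 + x^2.\<close>

lemma lifted_nth_0:
  assumes "lifted G h e n p F" "G $ 0 = 1" "h $ 0 = 1 + x" "e $ 0 = 1 + x ^ 2"
  shows "F $ 0 = poly p x"
  using assms by induction (simp_all add: fps_power_zeroth power2_eq_square algebra_simps)

text \<open>The quadratic factor is \<beta> y + n \<nu> z and the cubic is (1 - x) z. The terms with
  a combine by y + (1 - x) = 2, those with b by z + x (1 - x) = y.\<close>

lemma T_step_monomial:
  fixes \<beta> \<nu> :: real
  defines "y \<equiv> [:1, 1:]" and "z \<equiv> [:1, 0, 1:]"
  shows "[:\<beta> + real (a + 2 * b) * \<nu>, \<beta>, real (a + 2 * b) * \<nu>:] * (y ^ a * z ^ b)
       + smult \<nu> [:1, -1, 1, -1:] * pderiv (y ^ a * z ^ b)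
     = smult (\<beta> + 2 * \<nu> * real b) (y ^ Suc a * z ^ b)
       + smult (2 * \<nu> * real a) (y ^ (a - 1) * z ^ Suc b)"
proof (rule poly_ext)
  fix x :: real
  have dy: "poly (pderiv (y ^ a)) x = real a * (1 + x) ^ (a - 1)"
    by (cases a) (simp_all add: y_def pderiv_power_Suc pderiv_pCons del: power_Suc)
  have dz: "poly (pderiv (z ^ b)) x = real b * (1 + x * x) ^ (b - 1) * (2 * x)"
    by (cases b) (simp_all add: z_def pderiv_power_Suc pderiv_pCons del: power_Suc)
  show "poly ([:\<beta> + real (a + 2 * b) * \<nu>, \<beta>, real (a + 2 * b) * \<nu>:] * (y ^ a * z ^ b)
       + smult \<nu> [:1, -1, 1, -1:] * pderiv (y ^ a * z ^ b)) x
     = poly (smult (\<beta> + 2 * \<nu> * real b) (y ^ Suc a * z ^ b)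
       + smult (2 * \<nu> * real a) (y ^ (a - 1) * z ^ Suc b)) x"
    unfolding pderiv_mult poly_add poly_mult poly_smult dy dz
    by (cases a; cases b) (simp_all add: y_def z_def algebra_simps)
qed

text \<open>By the product rule, d/dt of G h^a e^b has the two coefficients of
  \<open>T_step_monomial\<close>, with h and e in place of y and z. Both operators are linear, so
  monomials suffice.\<close>

lemma lifted_step:
  fixes \<beta> \<nu> :: real
  assumes G: "fps_deriv G = fps_const \<beta> * h * G"
    and h: "fps_deriv h = fps_const (2 * \<nu>) * e"
    and e: "fps_deriv e = fps_const (2 * \<nu>) * h * e"
  assumes "lifted G h e n p F"
  shows "lifted G h e (Suc n) ([:\<beta> + real n * \<nu>, \<beta>, real n * \<nu>:] * p
     + smult \<nu> [:1, -1, 1, -1:] * pderiv p) (fps_deriv F)"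
  using assms(4)
proof induction
  case (monomial a b)
  let ?y = "[:1, 1:] :: real poly" and ?z = "[:1, 0, 1:] :: real poly"
  have main: "lifted G h e (Suc (a + 2 * b))
      (smult (\<beta> + 2 * \<nu> * real b) (?y ^ Suc a * ?z ^ b))
      (fps_const (\<beta> + 2 * \<nu> * real b) * (G * h ^ Suc a * e ^ b))"
    using lifted.smult[OF lifted.monomial[of G h e "Suc a" b]] by simp
  have eb: "fps_deriv (e ^ b) = fps_const (2 * \<nu> * real b) * h * e ^ b" for b
    by (induction b) (simp_all add: e algebra_simps flip: fps_const_add fps_const_mult)
  have hc: "fps_deriv (h ^ Suc c) = fps_const (2 * \<nu> * real (Suc c)) * h ^ c * e" for c
    by (induction c) (simp_all add: h algebra_simps flip: fps_const_add fps_const_mult)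
  show ?case
  proof (cases a)
    \<comment> \<open>Here \<open>a - 1\<close> truncates to 0 and the second monomial would have
      the wrong weight 2b + 2, but its coefficient is 0.\<close>
    case 0
    have F: "fps_deriv (G * h ^ a * e ^ b) = fps_const (\<beta> + 2 * \<nu> * real b) * (G * h ^ Suc a * e ^ b)"
      by (simp add: 0 G eb algebra_simps flip: fps_const_add fps_const_mult)
    from main show ?thesis
      unfolding F T_step_monomial by (simp add: 0)
  next
    case (Suc c)
    have F: "fps_deriv (G * h ^ a * e ^ b) = fps_const (\<beta> + 2 * \<nu> * real b) * (G * h ^ Suc a * e ^ b)
        + fps_const (2 * \<nu> * real a) * (G * h ^ c * e ^ Suc b)"
      unfolding Suc fps_deriv_mult hc eb G
      by (simp add: algebra_simps flip: fps_const_add fps_const_mult)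
    have "Suc (a + 2 * b) = c + 2 * Suc b" by (simp add: Suc)
    then have "lifted G h e (Suc (a + 2 * b))
      (smult (2 * \<nu> * real a) (?y ^ (a - 1) * ?z ^ Suc b))
      (fps_const (2 * \<nu> * real a) * (G * h ^ c * e ^ Suc b))"
      using lifted.smult[OF lifted.monomial[of G h e c "Suc b"]] by (metis Suc diff_Suc_1)
    from lifted.add[OF main this] show ?thesis unfolding F T_step_monomial .
  qed
next
  case (add n p F q H)
  from lifted.add[OF add.IH] show ?case
    by (simp only: pderiv_add fps_deriv_add smult_add_right distrib_left add_ac)
next
  case (smult n p F c)
  from lifted.smult[OF smult.IH, of c] show ?case
    by (simp only: pderiv_smult fps_deriv_mult_const_left mult_smult_right mult_smult_left
        smult_add_right smult_smult mult.commute[of c \<nu>])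
qed

section \<open>The exponential generating function and the column series\<close>

text \<open>Substitute f - 1 into the differential equation (1 + X) B' = a B of the binomial series
  and apply the chain rule.\<close>

lemma fps_deriv_fps_rpow:
  assumes "f $ 0 = 1"
  shows "f * fps_deriv (fps_rpow f a) = fps_const a * fps_deriv f * fps_rpow f a"
proof -
  have 0: "(f - 1) $ 0 = 0" using assms by simp
  have "(1 + fps_X) * fps_deriv (fps_binomial a) = fps_const a * fps_binomial a"
    by (simp add: fps_binomial_deriv fps_divide_unit mult.assoc inverse_mult_eq_1')
  then have "((1 + fps_X) * fps_deriv (fps_binomial a)) oo (f - 1) = (fps_const a * fps_binomial a) oo (f - 1)"
    by simp
  then have "f * (fps_deriv (fps_binomial a) oo (f - 1)) = fps_const a * fps_rpow f a"
    by (simp add: fps_compose_mult_distrib[OF 0] fps_compose_add_distrib fps_X_fps_compose_startby0[OF 0] fps_rpow_def)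
  then show ?thesis
    by (simp add: fps_rpow_def fps_compose_deriv[OF 0] mult.assoc mult.left_commute)
qed


context
  fixes \<beta> \<nu> x :: real
begin

definition egf_base :: "real fps" where
  "egf_base = fps_cos (\<nu> * (1 - x)) - fps_const ((1 + x) / (1 - x)) * fps_sin (\<nu> * (1 - x))"

definition egf :: "real fps" where
  "egf = fps_rpow egf_base (- \<beta> / \<nu>)"

text \<open>The series h of the overview, with f and G being \<open>egf_base\<close> and
  \<open>egf\<close>. The factor -1/\<nu> makes it start with 1 + x.\<close>

definition log_deriv :: "real fps" where
  "log_deriv = - fps_const (1 / \<nu>) * fps_deriv egf_base * inverse egf_base"

context
  assumes x: "x \<noteq> 1" and \<nu>: "\<nu> > 0"
begin

lemma egf_base_nth_0 [simp]: "egf_base $ 0 = 1"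
  by (simp add: egf_base_def)

lemma egf_nth_0: "egf $ 0 = 1"
  by (simp add: egf_def fps_rpow_def)

lemma fps_deriv_egf_base_nth_0: "fps_deriv egf_base $ 0 = - \<nu> * (1 + x)"
  using x by (simp add: egf_base_def fps_cos_deriv fps_sin_deriv)

lemma fps_deriv_2_egf_base:
  "fps_deriv (fps_deriv egf_base) = - fps_const ((\<nu> * (1 - x)) ^ 2) * egf_base"
proof -
  have "fps_deriv (fps_deriv (fps_cos c - fps_const k * fps_sin c))
      = - fps_const (c ^ 2) * (fps_cos c - fps_const k * fps_sin c)" for c k :: real
    by (simp add: fps_cos_deriv fps_sin_deriv power2_eq_square algebra_simps
          flip: fps_const_mult fps_const_neg)
  then show ?thesis unfolding egf_base_def .
qed

lemma fps_deriv_egf_base: "fps_deriv egf_base = - fps_const \<nu> * (egf_base * log_deriv)"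
proof -
  have "- fps_const \<nu> * (egf_base * log_deriv)
      = fps_const (\<nu> * (1 / \<nu>)) * fps_deriv egf_base * (egf_base * inverse egf_base)"
    unfolding log_deriv_def fps_const_mult[symmetric] by (simp add: algebra_simps)
  then show ?thesis using \<nu> by (simp add: inverse_mult_eq_1')
qed

lemma log_deriv_nth_0: "log_deriv $ 0 = 1 + x"
  using \<nu> fps_deriv_egf_base_nth_0 by (simp add: log_deriv_def)

lemma egf_base_nonzero: "egf_base \<noteq> 0"
  by (metis egf_base_nth_0 fps_zero_nth zero_neq_one)

text \<open>The exponent -\<beta>/\<nu> and the factor -\<nu> of f' = -\<nu> f h multiply to
  \<beta>; then f cancels.\<close>

lemma fps_deriv_egf: "fps_deriv egf = fps_const \<beta> * log_deriv * egf"
proof -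
  have "egf_base * fps_deriv egf = fps_const (- \<beta> / \<nu>) * fps_deriv egf_base * egf"
    unfolding egf_def by (rule fps_deriv_fps_rpow) simp
  also have "\<dots> = fps_const (- \<beta> / \<nu> * - \<nu>) * egf_base * log_deriv * egf"
    unfolding fps_deriv_egf_base fps_const_mult[symmetric] by (simp flip: fps_const_neg)
  also have "\<dots> = egf_base * (fps_const \<beta> * log_deriv * egf)"
    using \<nu> by simp
  finally show ?thesis using egf_base_nonzero by simp
qed

text \<open>A Riccati equation: differentiate f' = -\<nu> f h, compare with the oscillator equation
  for f'', and cancel f.\<close>

lemma fps_deriv_log_deriv:
  "fps_deriv log_deriv = fps_const \<nu> * (log_deriv ^ 2 + fps_const ((1 - x) ^ 2))"
proof -
  have "fps_deriv (fps_deriv egf_base)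
      = - fps_const \<nu> * (fps_deriv egf_base * log_deriv + egf_base * fps_deriv log_deriv)"
    by (subst fps_deriv_egf_base) (simp add: algebra_simps)
  then have "fps_const \<nu> * (egf_base * fps_deriv log_deriv)
     = fps_const \<nu> * (egf_base * (fps_const \<nu> * (log_deriv ^ 2 + fps_const ((1 - x) ^ 2))))"
    using fps_deriv_2_egf_base fps_deriv_egf_base
    unfolding power_mult_distrib fps_const_mult[symmetric] power2_eq_square[of \<nu>] by algebra
  then show ?thesis using egf_base_nonzero \<nu> by simp
qed

lemma poly_T_poly_eq_egf_nth: "poly (T_poly \<beta> \<nu> n) x = fact n * egf $ n"
proof -
  \<comment> \<open>The factor 1/2 makes e start with ((1 + x)^2 + (1 - x)^2) / 2 = 1 + x^2.\<close>
  define e where "e = fps_const (1 / 2) * (log_deriv ^ 2 + fps_const ((1 - x) ^ 2))"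
  have two: "fps_const 2 * fps_const (1 / 2) = (1 :: real fps)" by simp
  have h: "fps_deriv log_deriv = fps_const (2 * \<nu>) * e"
    unfolding fps_deriv_log_deriv e_def fps_const_mult[symmetric] using two by algebra
  have e: "fps_deriv e = fps_const (2 * \<nu>) * log_deriv * e"
  proof -
    have "fps_deriv e = fps_const (1 / 2 * 2) * log_deriv * fps_deriv log_deriv"
      unfolding e_def fps_const_mult[symmetric]
      by (simp add: power2_eq_square fps_numeral_fps_const algebra_simps flip: fps_const_mult)
    then show ?thesis by (simp add: h)
  qed
  have "lifted egf log_deriv e n (T_poly \<beta> \<nu> n) (fps_nth_deriv n egf)" for n
  proof (induction n)
    case 0
    show ?case using lifted.monomial[of egf log_deriv e 0 0] by simp
  next
    case (Suc n)
    from lifted_step[OF fps_deriv_egf h e this] show ?case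
      by (simp only: T_poly.simps fps_nth_deriv_commute)
  qed
  then have "fps_nth_deriv n egf $ 0 = poly (T_poly \<beta> \<nu> n) x"
    by (rule lifted_nth_0)
       (simp_all add: egf_nth_0 log_deriv_nth_0 e_def fps_power_zeroth power2_eq_square field_simps)
  then show ?thesis by (simp add: fps_deriv_maclauren_0)
qed

text \<open>The array is an exponential Riordan array: \<open>W k\<close> below is the exponential
  generating function of column k, and the row recurrence becomes a differential equation linking
  \<open>W (k - 1)\<close>, \<open>W k\<close> and \<open>W (k + 1)\<close>.\<close>

lemma poly_jacobi_array_eq_egf_nth:
  "poly (jacobi_array (T_diag \<beta> \<nu>) (T_offdiag \<beta> \<nu>) n 0) x = fact n * egf $ n"
proof -
  define z where "z = 1 + x ^ 2"
  have z: "z > 0" unfolding z_def by (simp add: add_pos_nonneg)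
  \<comment> \<open>Scaled so that \<phi> = t + ..., which gives a rise the weight 1.\<close>
  define \<phi> where "\<phi> = fps_const (1 / (2 * \<nu> * z)) * (log_deriv - fps_const (1 + x))"
  define W where "W k = fps_const (1 / fact k) * egf * \<phi> ^ k" for k :: nat
  define r where "r k = (2 * \<nu> * real k + \<beta>) * (1 + x)" for k :: nat
  define s where "s k = 2 * \<nu> * real k * (\<beta> + \<nu> * (real k - 1)) * z" for k :: nat
  have h: "log_deriv = fps_const (1 + x) + fps_const (2 * \<nu> * z) * \<phi>"
  proof -
    have "fps_const (2 * \<nu> * z) * \<phi>
        = fps_const (2 * \<nu> * z * (1 / (2 * \<nu> * z))) * (log_deriv - fps_const (1 + x))"
      unfolding \<phi>_def fps_const_mult[symmetric] by (simp only: mult.assoc)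
    then show ?thesis using \<nu> z by simp
  qed
  have \<phi>': "fps_deriv \<phi> = 1 + fps_const (2 * \<nu> * (1 + x)) * \<phi> + fps_const (2 * \<nu> ^ 2 * z) * \<phi> ^ 2"
  proof -
    have "fps_const (2 * \<nu> * z) * fps_deriv \<phi> = fps_deriv log_deriv"
      by (subst h) simp
    also have "\<dots> = fps_const (2 * \<nu> * z)
        * (1 + fps_const (2 * \<nu> * (1 + x)) * \<phi> + fps_const (2 * \<nu> ^ 2 * z) * \<phi> ^ 2)"
    proof -
      define y where "y = 1 + x"
      \<comment> \<open>With h = y + 2 \<nu> z \<phi>, this makes y^2 cancel in h^2 + (1 - x)^2,
        leaving a multiple of 2z.\<close>
      have w: "(1 - x) ^ 2 = 2 * z - y * y"
        by (simp add: z_def y_def power2_eq_square algebra_simps)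
      show ?thesis
        unfolding fps_deriv_log_deriv unfolding h w y_def[symmetric] power2_eq_square[of \<nu>]
        by (simp only: fps_const_mult[symmetric] fps_const_sub[symmetric] fps_numeral_fps_const[symmetric])
           algebra
    qed
    finally show ?thesis using \<nu> z by simp
  qed
  have W0: "fps_deriv (W 0) = fps_const (r 0) * W 0 + fps_const (s 1) * W 1"
    unfolding W_def r_def s_def
    by (simp add: fps_deriv_egf) (subst h, simp add: algebra_simps flip: fps_const_mult fps_const_add)
  have WSuc: "fps_deriv (W (Suc k)) = W k + fps_const (r (Suc k)) * W (Suc k)
      + fps_const (s (Suc (Suc k))) * W (Suc (Suc k))" for k
  proof -
    \<comment> \<open>All factorials are expressed through the largest one, so that the claim
      becomes a ring identity.\<close>
    define c where "c = (1 / fact (Suc (Suc k)) :: real)"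
    have c: "1 / fact k = (real k + 1) * (real k + 2) * c" "1 / fact (Suc k) = (real k + 2) * c"
      by (simp_all add: c_def divide_simps) (simp add: algebra_simps)
    have pow: "fps_deriv (\<phi> ^ Suc k) = fps_const (real k + 1) * \<phi> ^ k * fps_deriv \<phi>"
      by (induction k) (simp_all add: algebra_simps flip: fps_const_add)
    have "fps_deriv (W (Suc k)) = fps_const ((real k + 2) * c)
        * (fps_const \<beta> * log_deriv * egf * \<phi> ^ Suc k + egf * (fps_const (real k + 1) * \<phi> ^ k * fps_deriv \<phi>))"
      unfolding W_def c mult.assoc[of "fps_const _"] fps_deriv_mult fps_deriv_const pow fps_deriv_egf
      by (simp add: algebra_simps)
    also have "\<dots> = W k + fps_const (r (Suc k)) * W (Suc k) + fps_const (s (Suc (Suc k))) * W (Suc (Suc k))"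
      unfolding W_def c_def[symmetric] c \<phi>' r_def s_def h power_Suc power2_eq_square of_nat_Suc
        fps_const_mult[symmetric] fps_const_add[symmetric] fps_const_sub[symmetric]
      by (simp only: fps_const_1_eq_1 fps_numeral_fps_const[symmetric]) algebra
    finally show ?thesis .
  qed
  have W_nth_0: "W k $ 0 = (if k = 0 then 1 else 0)" for k
    by (simp add: W_def \<phi>_def egf_nth_0 log_deriv_nth_0 fps_power_zeroth)
  \<comment> \<open>Passing from n to n + 1 on the left is differentiation of \<open>W k\<close>, so
    \<open>W0\<close> and \<open>WSuc\<close> reproduce the row recurrence.\<close>
  have "fact n * W k $ n = poly (jacobi_array (T_diag \<beta> \<nu>) (T_offdiag \<beta> \<nu>) n k) x" for k
  proof (induction n arbitrary: k)
    case 0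
    show ?case by (simp add: W_nth_0)
  next
    case (Suc n)
    have r: "poly (T_diag \<beta> \<nu> k) x = r k" for k
      by (simp add: T_diag_def r_def algebra_simps)
    have s: "poly (T_offdiag \<beta> \<nu> k) x = s k" for k
      by (simp add: T_offdiag_def s_def z_def power2_eq_square algebra_simps)
    have step: "fact (Suc n) * W k $ Suc n = fact n * (fps_deriv (W k) $ n)" for k
      by (simp add: algebra_simps)
    show ?case
    proof (cases k)
      case 0
      then show ?thesis
        unfolding 0 step W0 by (simp add: jacobi_array_Suc_0 r s distrib_left flip: Suc.IH)
    next
      case (Suc j)
      then show ?thesis
        unfolding Suc step WSuc by (simp add: jacobi_array_Suc_Suc r s distrib_left flip: Suc.IH)
    qed
  qed
  from this[of 0] show ?thesis by (simp add: W_def)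
qed

end

end

section \<open>Identification with the array, and log-convexity\<close>

text \<open>Both polynomials take the value n! [t^n] G at every x other than 1, so their difference
  has infinitely many roots.\<close>

lemma T_poly_eq_jacobi_array:
  assumes "\<nu> > 0"
  shows "T_poly \<beta> \<nu> n = jacobi_array (T_diag \<beta> \<nu>) (T_offdiag \<beta> \<nu>) n 0"
proof (rule ccontr)
  let ?d = "T_poly \<beta> \<nu> n - jacobi_array (T_diag \<beta> \<nu>) (T_offdiag \<beta> \<nu>) n 0"
  assume "T_poly \<beta> \<nu> n \<noteq> jacobi_array (T_diag \<beta> \<nu>) (T_offdiag \<beta> \<nu>) n 0"
  then have "finite {x. poly ?d x = 0}" by (intro poly_roots_finite) simp
  moreover have "UNIV - {1} \<subseteq> {x. poly ?d x = 0}"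
    using assms by (auto simp: poly_T_poly_eq_egf_nth poly_jacobi_array_eq_egf_nth)
  ultimately show False
    using infinite_UNIV_char_0 by (metis finite_Diff_insert finite_subset Diff_empty)
qed

lemma strongly_q_log_convex_T_poly:
  assumes "\<nu> > 0" "\<beta> \<ge> 0"
  shows "strongly_q_log_convex (T_poly \<beta> \<nu>)"
proof -
  have "nonneg_coeffs (T_diag \<beta> \<nu> k * T_diag \<beta> \<nu> (Suc k) - T_offdiag \<beta> \<nu> (Suc k))" for k
  proof -
    \<comment> \<open>The product of the diagonal entries is a (1 + x)^2 and the other term is b (1
      + x^2), so the difference has coefficients a - b, 2a, a - b.\<close>
    define a where "a = (2 * \<nu> * real k + \<beta>) * (2 * \<nu> * real (Suc k) + \<beta>)"
    define b where "b = 2 * \<nu> * real (Suc k) * (\<beta> + \<nu> * real k)"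
    have "a - b = 2 * \<nu> * \<nu> * real k * real k + 2 * \<nu> * \<nu> * real k + 2 * \<nu> * real k * \<beta> + \<beta> * \<beta>"
      by (simp add: a_def b_def algebra_simps)
    then have "a - b \<ge> 0" using assms by simp
    moreover have "a \<ge> 0" unfolding a_def using assms by simp
    moreover have "T_diag \<beta> \<nu> k * T_diag \<beta> \<nu> (Suc k) - T_offdiag \<beta> \<nu> (Suc k) = [:a - b, 2 * a, a - b:]"
      unfolding T_diag_def T_offdiag_def a_def b_def by (simp add: algebra_simps)
    ultimately show ?thesis by simp
  qed
  moreover have "nonneg_coeffs (T_diag \<beta> \<nu> k)" "nonneg_coeffs (T_offdiag \<beta> \<nu> (Suc k))" for k
    using assms by (simp_all add: T_diag_def T_offdiag_def)
  ultimately have "strongly_q_log_convex (\<lambda>n. jacobi_array (T_diag \<beta> \<nu>) (T_offdiag \<beta> \<nu>) n 0)"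
    by (intro strongly_q_log_convex_jacobi_array)
  then show ?thesis by (simp flip: T_poly_eq_jacobi_array[OF assms(1)])
qed

section \<open>Failure of gamma-positivity\<close>

text \<open>The recurrence has negative coefficients in its cubic factor; the array has only
  nonnegative weights.\<close>

lemma nonneg_coeffs_T_poly:
  assumes "\<nu> > 0" "\<beta> \<ge> 0"
  shows "nonneg_coeffs (T_poly \<beta> \<nu> n)"
  unfolding T_poly_eq_jacobi_array[OF assms(1)] using assms
  by (intro nonneg_coeffs_jacobi_array) (simp_all add: T_diag_def T_offdiag_def)

text \<open>At x = 0 each step multiplies by \<beta> + n \<nu> and adds \<nu> times a nonnegative
  derivative. The factor exceeds \<beta> once n > 0, which makes the last step strict.\<close>

lemma power_less_T_poly_0:
  assumes "\<nu> > 0" "\<beta> > 0" "n \<ge> 2"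
  shows "\<beta> ^ n < poly (T_poly \<beta> \<nu> n) 0"
proof -
  have step: "poly (T_poly \<beta> \<nu> (Suc n)) 0 \<ge> (\<beta> + real n * \<nu>) * poly (T_poly \<beta> \<nu> n) 0" for n
    using nonneg_coeffs_T_poly[of \<nu> \<beta> n] assms
    by (simp add: nonneg_coeffs_def poly_0_coeff_0 coeff_pderiv)
  have le: "\<beta> ^ n \<le> poly (T_poly \<beta> \<nu> n) 0" for n
  proof (induction n)
    case (Suc n)
    have "\<beta> ^ Suc n \<le> (\<beta> + real n * \<nu>) * poly (T_poly \<beta> \<nu> n) 0"
      using Suc assms by (auto intro!: mult_mono)
    with step[of n] show ?case by linarith
  qed simp
  obtain k where n: "n = Suc k" and k: "k > 0" using assms(3) by (cases n) auto
  have "\<beta> * \<beta> ^ k < (\<beta> + real k * \<nu>) * poly (T_poly \<beta> \<nu> k) 0"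
    using le[of k] k assms by (intro mult_less_le_imp_less) auto
  with step[of k] show "\<beta> ^ n < poly (T_poly \<beta> \<nu> n) 0" by (simp add: n)
qed

text \<open>Modulo 1 + x^2 the cubic factor vanishes and the quadratic one is \<beta> (1 +
  x).\<close>

lemma T_poly_mod: "[:1, 0, 1:] dvd T_poly \<beta> \<nu> n - smult (\<beta> ^ n) ([:1, 1:] ^ n)"
proof (induction n)
  case (Suc n)
  let ?z = "[:1, 0, 1:] :: real poly" and ?y = "[:1, 1:] :: real poly"
  define p where "p = T_poly \<beta> \<nu> n"
  have 1: "[:\<beta> + real n * \<nu>, \<beta>, real n * \<nu>:] = smult \<beta> ?y + smult (real n * \<nu>) ?z"
    by simp
  have 2: "[:1, -1, 1, -1:] = [:1, -1:] * ?z" by simp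
  have "T_poly \<beta> \<nu> (Suc n) - smult (\<beta> ^ Suc n) (?y ^ Suc n)
      = smult \<beta> ?y * (p - smult (\<beta> ^ n) (?y ^ n))
        + ?z * (smult (real n * \<nu>) p + smult \<nu> ([:1, -1:] * pderiv p))"
    unfolding T_poly.simps p_def[symmetric] 1 2
    by (simp only: algebra_simps smult_add_right smult_diff_right mult_smult_left mult_smult_right power_Suc smult_smult)
  then show ?case using Suc unfolding p_def by (metis dvd_add dvd_mult dvd_triv_left)
qed (simp add: one_pCons)

text \<open>Modulo 1 + x^2 one has (1 + x)^2 = 2x, so each x may be traded for (1 + x)^2 /
  2.\<close>

lemma gamma_basis_mod:
  assumes "2 * k \<le> d"
  shows "[:1, 0, 1:] dvd [:0, 1:] ^ k * [:1, 1:] ^ (d - 2 * k) - smult ((1 / 2) ^ k) ([:1, 1:] ^ d :: real poly)"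
  using assms
proof (induction k)
  case (Suc k)
  let ?z = "[:1, 0, 1:] :: real poly" and ?y = "[:1, 1:] :: real poly" and ?x = "[:0, 1:] :: real poly"
  define q where "q = ?x ^ k * ?y ^ (d - 2 * Suc k)"
  have "d - 2 * k = Suc (Suc (d - 2 * Suc k))" using Suc.prems by simp
  then have "?x ^ k * ?y ^ (d - 2 * k) = q * ?y ^ 2"
    by (simp only: q_def power_Suc power2_eq_square mult_ac)
  moreover have "?y ^ 2 = smult 2 ?x + ?z" by (simp add: power2_eq_square)
  ultimately have "?x ^ Suc k * ?y ^ (d - 2 * Suc k)
      = smult (1 / 2) (?x ^ k * ?y ^ (d - 2 * k)) - ?z * smult (1 / 2) q"
    by (simp only: q_def power_Suc algebra_simps smult_add_right mult_smult_right smult_smult) simp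
  then have "?x ^ Suc k * ?y ^ (d - 2 * Suc k) - smult ((1 / 2) ^ Suc k) (?y ^ d)
      = smult (1 / 2) (?x ^ k * ?y ^ (d - 2 * k) - smult ((1 / 2) ^ k) (?y ^ d)) - ?z * smult (1 / 2) q"
    by (simp only: smult_diff_right smult_smult power_Suc algebra_simps)
  moreover have "?z dvd \<dots>"
    using Suc by (intro dvd_diff[OF dvd_smult dvd_triv_left]) auto
  ultimately show ?case by simp
qed simp

text \<open>1 + x is a unit modulo 1 + x^2, by 2 = (1 + x^2) - (x - 1)(x + 1).\<close>

lemma dvd_mult_linear_power_cancel:
  fixes p :: "real poly"
  assumes "[:1, 0, 1:] dvd p * [:1, 1:] ^ n"
  shows "[:1, 0, 1:] dvd p"
  using assms
proof (induction n)
  case (Suc n)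
  let ?z = "[:1, 0, 1:] :: real poly" and ?y = "[:1, 1:] :: real poly"
  have eq: "[:2:] = ?z - [:-1, 1:] * ?y" by simp
  have "[:2:] * (p * ?y ^ n) = p * ?y ^ n * ?z - [:-1, 1:] * (p * ?y ^ Suc n)"
    by (simp only: eq algebra_simps power_Suc)
  then have "?z dvd [:2:] * (p * ?y ^ n)"
    using Suc.prems by (metis dvd_diff dvd_mult dvd_triv_right)
  then show ?case using Suc.IH by (simp add: dvd_smult_iff)
qed simp

lemma not_gamma_positive_T_poly:
  assumes \<nu>: "\<nu> > 0" and \<beta>: "\<beta> > 0" and n: "n \<ge> 2" and deg: "degree (T_poly \<beta> \<nu> n) = n"
  shows "\<not> gamma_positive (T_poly \<beta> \<nu> n)"
proof
  let ?z = "[:1, 0, 1:] :: real poly" and ?y = "[:1, 1:] :: real poly" and ?x = "[:0, 1:] :: real poly"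
  assume "gamma_positive (T_poly \<beta> \<nu> n)"
  then obtain g :: "nat \<Rightarrow> real" where g: "\<And>k. k \<le> n div 2 \<Longrightarrow> g k \<ge> 0"
    and T: "T_poly \<beta> \<nu> n = (\<Sum>k \<le> n div 2. smult (g k) (?x ^ k * ?y ^ (n - 2 * k)))"
    unfolding gamma_positive_def deg by auto
  \<comment> \<open>The polynomial is congruent to S (1 + x)^n by its gamma expansion and to
    \<beta>^n (1 + x)^n by the recurrence.\<close>
  define S where "S = (\<Sum>k \<le> n div 2. g k * (1 / 2) ^ k)"
  have "T_poly \<beta> \<nu> n - smult S (?y ^ n)
      = (\<Sum>k \<le> n div 2. smult (g k) (?x ^ k * ?y ^ (n - 2 * k) - smult ((1 / 2) ^ k) (?y ^ n)))"
    unfolding T S_def by (simp add: smult_diff_right sum_subtractf smult_sum)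
  moreover have "?z dvd \<dots>"
    by (intro dvd_sum dvd_smult gamma_basis_mod) auto
  ultimately have "?z dvd (T_poly \<beta> \<nu> n - smult (\<beta> ^ n) (?y ^ n)) - (T_poly \<beta> \<nu> n - smult S (?y ^ n))"
    by (metis dvd_diff T_poly_mod)
  then have "?z dvd [:S - \<beta> ^ n:] * ?y ^ n"
    by (simp add: smult_diff_left)
  then have "?z dvd [:S - \<beta> ^ n:]"
    by (rule dvd_mult_linear_power_cancel)
  \<comment> \<open>A divisor of degree 2 forces the constant to be 0.\<close>
  then have "S = \<beta> ^ n"
    using dvd_imp_degree_le[of ?z "[:S - \<beta> ^ n:]"] by (cases "S = \<beta> ^ n") auto
  moreover have "poly (T_poly \<beta> \<nu> n) 0 = g 0"
  proof -
    have "poly (T_poly \<beta> \<nu> n) 0 = (\<Sum>k \<le> n div 2. if k = 0 then g 0 else 0)"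
      unfolding T by (auto simp: poly_sum intro!: sum.cong)
    then show ?thesis by simp
  qed
  moreover have "g 0 \<le> S"
    unfolding S_def using member_le_sum[of 0 "{..n div 2}" "\<lambda>k. g k * (1 / 2) ^ k"] g by simp
  ultimately show False using power_less_T_poly_0[OF \<nu> \<beta> n] by simp
qed


section \<open>Transfer to the sequence \<open>T\<close>\<close>

theorem theorem4p7:
  fixes \<delta> :: nat and \<beta> \<nu> :: real and T :: "nat \<Rightarrow> real poly"
  assumes "\<delta> \<ge> 1" and "\<nu> > 0"
    and "T (\<delta> - 1) = 1"
    and "\<And>n. n \<ge> \<delta> - 1 \<Longrightarrow> degree (T n) = n + 1 - \<delta>"
    and "\<And>n. n \<ge> \<delta> - 1 \<Longrightarrow>
           T (n + 1) = [:\<beta> + real (n + 1 - \<delta>) * \<nu>, \<beta>, real (n + 1 - \<delta>) * \<nu>:] * T n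
                       + smult \<nu> [:1, -1, 1, -1:] * pderiv (T n)"
  shows
    "(\<forall>x::real. x \<noteq> 1 \<longrightarrow>
        Abs_fps (\<lambda>n. poly (T (n + \<delta> - 1)) x / fact n) =
        fps_rpow (fps_cos (\<nu> * (1 - x)) - fps_const ((1 + x) / (1 - x)) * fps_sin (\<nu> * (1 - x)))
                 (- \<beta> / \<nu>)) \<and>
     has_jfrac_expansion
       (Abs_fps (\<lambda>n. T (n + \<delta> - 1)))
       (\<lambda>i. smult (2 * \<nu> * real i + \<beta>) [:1, 1:])
       (\<lambda>i. smult (2 * \<nu> * real i * (\<beta> + \<nu> * (real i - 1))) [:1, 0, 1:]) \<and>
     (\<beta> \<ge> 0 \<longrightarrow> strongly_q_log_convex (\<lambda>n. T (n + \<delta> - 1))) \<and>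
     (\<beta> \<ge> 0 \<longrightarrow> (\<forall>n \<ge> \<delta> + 2. \<not> gamma_positive (T n)))"
proof -
  define U where "U = (\<lambda>n. T (n + \<delta> - 1))"
  have U: "U = T_poly \<beta> \<nu>"
  proof
    fix n show "U n = T_poly \<beta> \<nu> n"
    proof (induction n)
      case (Suc n)
      have "T (n + \<delta> - 1 + 1) = [:\<beta> + real n * \<nu>, \<beta>, real n * \<nu>:] * U n
          + smult \<nu> [:1, -1, 1, -1:] * pderiv (U n)"
        unfolding U_def using assms(1) by (subst assms(5)) auto
      moreover have "n + \<delta> - 1 + 1 = Suc n + \<delta> - 1" using assms(1) by simp
      ultimately show ?case using Suc unfolding U_def by simp
    qed (use assms(3) in \<open>simp add: U_def\<close>)
  qed
  have T: "T n = T_poly \<beta> \<nu> (n + 1 - \<delta>)" if "n \<ge> \<delta>" for n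
    using that assms(1) by (simp flip: U add: U_def)
  \<comment> \<open>The polynomial at index \<delta> is \<beta> (1 + x), and it has degree 1. Hence
    \<beta> \<ge> 0 gives \<beta> > 0 in the last claim.\<close>
  have \<beta>: "\<beta> \<noteq> 0"
    using assms(1) assms(4)[of \<delta>] T[of \<delta>] by auto
  have "Abs_fps (\<lambda>n. poly (U n) x / fact n) =
        fps_rpow (fps_cos (\<nu> * (1 - x)) - fps_const ((1 + x) / (1 - x)) * fps_sin (\<nu> * (1 - x)))
                 (- \<beta> / \<nu>)" if "x \<noteq> 1" for x
    using poly_T_poly_eq_egf_nth[OF that assms(2)] that assms(2)
    unfolding U egf_def egf_base_def by (intro fps_ext) simp
  moreover have "has_jfrac_expansion (Abs_fps U)
       (\<lambda>i. smult (2 * \<nu> * real i + \<beta>) [:1, 1:])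
       (\<lambda>i. smult (2 * \<nu> * real i * (\<beta> + \<nu> * (real i - 1))) [:1, 0, 1:])"
    using has_jfrac_expansion_jacobi_column[of "T_diag \<beta> \<nu>" "T_offdiag \<beta> \<nu>"]
    unfolding U jacobi_column_def T_poly_eq_jacobi_array[OF assms(2), symmetric]
    by (simp add: T_diag_def[abs_def] T_offdiag_def[abs_def])
  moreover have "strongly_q_log_convex U" if "\<beta> \<ge> 0"
    unfolding U using assms(2) that by (rule strongly_q_log_convex_T_poly)
  moreover have "\<not> gamma_positive (T n)" if "\<beta> \<ge> 0" "n \<ge> \<delta> + 2" for n
    using not_gamma_positive_T_poly[of \<nu> \<beta> "n + 1 - \<delta>"] assms(4)[of n] T[of n] that \<beta> assms(2)
    by simp
  ultimately show ?thesis unfolding U_def by blast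
qed

end
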